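(* Let $f\colon\mathbb Z_p\to\mathbb Z_p$ be uniformly differentiable modulo $p^2$ on $\mathbb Z_p$ with integer-valued derivative modulo $p^2$. Then $f$ is asymptotically ergodic if and only if $f$ is transitive modulo $p^{N_2(f)+1}$ when $p$ is odd, respectively transitive modulo $2^{N_2(f)+2}$ when $p=2$.
   Context: $\mathbb Z_p$, $\mathbb Q_p$, $\|\cdot\|_p$ are the $p$-adic integers, numbers and norm; $a\equiv b\pmod{p^s}$ means $\|a-b\|_p\le p^{-s}$. $f$ is uniformly differentiable modulo $p^k$ on $\mathbb Z_p$ if there exist $N\in\mathbb N$ and for every $u\in\mathbb Z_p$ an element $f'_k(u)\in\mathbb Q_p$ such that for every integer $K\ge N$, every $u\in\mathbb Z_p$ and every $h\in\mathbb Z_p$ with $\|h\|_p\le p^{-K}$: $f(u+h)\equiv f(u)+hf'_k(u)\pmod{p^{k+K}}$; the least such $N$ is $N_k(f)$. The derivative modulo $p^k$ is integer-valued if $f'_k(u)$ can be chosen in $\mathbb Z_p$ for every $u$. $f$ is transitive modulo $p^k$ if the map $\{0,\dots,p^k-1\}\to\mathbb Z/p^k$, $x\mapsto f(x)\bmod p^k$ (identifying $\{0,\dots,p^k-1\}$ with $\mathbb Z/p^k$) is a single-cycle permutation; $f$ is asymptotically ergodic if it is transitive modulo $p^k$ for all sufficiently large $k$. *)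

theory Defs
  imports
    "HOL-Computational_Algebra.Polynomial_Factorial"
    "HOL-Combinatorics.Orbits"
    "Berlekamp_Zassenhaus.Finite_Field"
begin

text \<open>
  The prime \<open>p\<close> is carried by a type: \<open>p = CARD('p)\<close> with \<open>'p :: prime_card\<close>.
  The \<open>p\<close>-adic integers are the inverse limit of the rings \<open>\<int>/p\<^sup>n\<close>, i.e. coherent sequences of
  least nonnegative residues, and the field of \<open>p\<close>-adic numbers is their fraction field.
\<close>

typedef (overloaded) ('p :: prime_card) padic_int =
  "{x :: nat \<Rightarrow> int. \<forall>n. x n \<in> {0..<int CARD('p) ^ n} \<and> x (Suc n) mod int CARD('p) ^ n = x n}"
  morphisms residue Abs_padic_int
  by (rule exI[of _ "\<lambda>_. 0"]) (simp add: zero_less_power)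

setup_lifting type_definition_padic_int

lemma mod_prime_power_Suc:
  "(a mod int q ^ Suc n) mod int q ^ n = a mod int q ^ n"
  by (simp add: mod_mod_cancel)

instantiation padic_int :: (prime_card) comm_ring_1
begin

lift_definition zero_padic_int :: "'a padic_int" is "\<lambda>_. 0"
  by simp

lift_definition one_padic_int :: "'a padic_int" is "\<lambda>n. 1 mod int CARD('a) ^ n"
  using mod_prime_power_Suc[of 1 "CARD('a)"] by (simp del: power_Suc)

lift_definition plus_padic_int :: "'a padic_int \<Rightarrow> 'a padic_int \<Rightarrow> 'a padic_int"
  is "\<lambda>x y n. (x n + y n) mod int CARD('a) ^ n"
  by (simp add: mod_prime_power_Suc del: power_Suc) (metis mod_add_eq)

lift_definition minus_padic_int :: "'a padic_int \<Rightarrow> 'a padic_int \<Rightarrow> 'a padic_int"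
  is "\<lambda>x y n. (x n - y n) mod int CARD('a) ^ n"
  by (simp add: mod_prime_power_Suc del: power_Suc) (metis mod_diff_eq)

lift_definition uminus_padic_int :: "'a padic_int \<Rightarrow> 'a padic_int"
  is "\<lambda>x n. (- x n) mod int CARD('a) ^ n"
  by (simp add: mod_prime_power_Suc del: power_Suc) (metis mod_minus_eq)

lift_definition times_padic_int :: "'a padic_int \<Rightarrow> 'a padic_int \<Rightarrow> 'a padic_int"
  is "\<lambda>x y n. (x n * y n) mod int CARD('a) ^ n"
  by (simp add: mod_prime_power_Suc del: power_Suc) (metis mod_mult_eq)

instance
proof
  fix a b c :: "'a padic_int"
  show "a * b * c = a * (b * c)" by transfer (simp add: mod_simps mult.assoc)
  show "a * b = b * a" by transfer (simp add: mult.commute)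
  show "1 * a = a" by transfer (simp add: mod_simps fun_eq_iff)
  show "a + b + c = a + (b + c)" by transfer (simp add: mod_simps add.assoc)
  show "a + b = b + a" by transfer (simp add: add.commute)
  show "0 + a = a" by transfer (simp add: fun_eq_iff)
  show "- a + a = 0" by transfer (simp add: mod_simps)
  show "a - b = a + - b" by transfer (simp add: mod_simps)
  show "(a + b) * c = a * c + b * c" by transfer (simp add: mod_simps distrib_right)
  show "(0 :: 'a padic_int) \<noteq> 1"
  proof
    assume "(0 :: 'a padic_int) = 1"
    then have "residue (0 :: 'a padic_int) 1 = residue 1 1" by simp
    moreover have "1 < CARD('a)" using prime_card[where 'a = 'a] by (rule prime_gt_1_nat)
    ultimately show False by transfer simp
  qed
qed

end

lemma residue_0 [simp]: "residue 0 n = 0"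
  by transfer simp

lemma residue_add: "residue (x + y :: 'p :: prime_card padic_int) n =
    (residue x n + residue y n) mod int CARD('p) ^ n"
  by transfer simp

lemma residue_diff: "residue (x - y :: 'p :: prime_card padic_int) n =
    (residue x n - residue y n) mod int CARD('p) ^ n"
  by transfer simp

lemma residue_mult: "residue (x * y :: 'p :: prime_card padic_int) n =
    (residue x n * residue y n) mod int CARD('p) ^ n"
  by transfer simp

lemma residue_bounds:
  "0 \<le> residue (x :: 'p :: prime_card padic_int) n" "residue x n < int CARD('p) ^ n"
  by (transfer; simp)+

lemma residue_of_nat:
  "residue (of_nat a :: 'p :: prime_card padic_int) n = int a mod int CARD('p) ^ n"
proof (induction a)
  case (Suc a)
  have "residue (1 :: 'p padic_int) n = 1 mod int CARD('p) ^ n" by transfer simp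
  with Suc show ?case by (simp add: residue_add mod_simps)
qed simp

lemma residue_mod:
  assumes "n \<le> m"
  shows "residue (x :: 'p :: prime_card padic_int) m mod int CARD('p) ^ n = residue x n"
  using assms
proof (induction m rule: dec_induct)
  case base
  show ?case using residue_bounds[of x n] by simp
next
  case (step m)
  have "residue x (Suc m) mod int CARD('p) ^ m = residue x m" by transfer simp
  moreover have "int CARD('p) ^ n dvd int CARD('p) ^ m"
    using step.hyps by (intro le_imp_power_dvd)
  ultimately show ?case using step.IH by (metis mod_mod_cancel)
qed

lemma padic_int_eqI: "(\<And>n. residue x n = residue y n) \<Longrightarrow> x = y"
  by (metis ext residue_inject)

definition padic_int_val :: "'p :: prime_card padic_int \<Rightarrow> nat" where
  "padic_int_val x = (LEAST n. residue x (Suc n) \<noteq> 0)"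

lemma residue_eq_0_iff:
  assumes "x \<noteq> 0"
  shows "residue x n = 0 \<longleftrightarrow> n \<le> padic_int_val (x :: 'p :: prime_card padic_int)"
proof -
  have z: "residue x 0 = 0" using residue_bounds[of x 0] by simp
  obtain m where m: "residue x m \<noteq> 0" using padic_int_eqI[of x 0] assms by auto
  with z obtain k where "m = Suc k" by (cases m) auto
  with m have ex: "residue x (Suc k) \<noteq> 0" by simp
  have l: "residue x (Suc (padic_int_val x)) \<noteq> 0"
    unfolding padic_int_val_def using ex by (rule LeastI)
  have s: "residue x (Suc j) = 0" if "j < padic_int_val x" for j
    using not_less_Least[OF that[unfolded padic_int_val_def]] by simp
  show ?thesis
  proof
    assume "residue x n = 0"
    then have "residue x i = 0" if "i \<le> n" for i using residue_mod[OF that, of x] by simp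
    with l show "n \<le> padic_int_val x" by (meson not_less_eq_eq)
  next
    assume "n \<le> padic_int_val x"
    then show "residue x n = 0" using z s by (cases n) auto
  qed
qed

lemma padic_int_val_mult_aux:
  fixes x y :: "'p :: prime_card padic_int"
  assumes "x \<noteq> 0" "y \<noteq> 0"
  defines "m \<equiv> padic_int_val x" and "l \<equiv> padic_int_val y"
  shows "residue (x * y) (m + l) = 0" "residue (x * y) (Suc (m + l)) \<noteq> 0"
proof -
  let ?p = "int CARD('p)"
  let ?N = "Suc (m + l)"
  have p: "prime ?p" using prime_card[where 'a = 'p] by simp
  have *: "\<exists>a. residue z ?N = ?p ^ padic_int_val z * a \<and> \<not> ?p dvd a"
    if "z \<noteq> 0" "padic_int_val z \<le> m + l" for z :: "'p padic_int"
  proof -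
    have "residue z ?N mod ?p ^ padic_int_val z = 0"
      using that residue_mod[of "padic_int_val z" ?N z] residue_eq_0_iff[of z] by simp
    then obtain a where a: "residue z ?N = ?p ^ padic_int_val z * a" by auto
    have "residue z ?N mod ?p ^ Suc (padic_int_val z) \<noteq> 0"
      using that residue_mod[of "Suc (padic_int_val z)" ?N z] residue_eq_0_iff[of z]
      by (simp del: power_Suc)
    with a have "\<not> ?p dvd a" by (auto simp: mod_eq_0_iff_dvd mult.commute)
    with a show ?thesis by blast
  qed
  obtain a where a: "residue x ?N = ?p ^ m * a" "\<not> ?p dvd a"
    using *[of x] assms by (auto simp: m_def)
  obtain b where b: "residue y ?N = ?p ^ l * b" "\<not> ?p dvd b"
    using *[of y] assms by (auto simp: l_def)
  have ab: "residue x ?N * residue y ?N = ?p ^ (m + l) * (a * b)"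
    by (simp add: a b power_add)
  have "\<not> ?p dvd a * b" using a b p by (simp add: prime_dvd_mult_iff)
  then have "\<not> ?p ^ ?N dvd ?p ^ (m + l) * (a * b)"
    by (simp add: mult.commute)
  then show "residue (x * y) ?N \<noteq> 0"
    by (simp add: residue_mult ab mod_eq_0_iff_dvd del: power_Suc)
  have "residue (x * y) (m + l) = residue (x * y) ?N mod ?p ^ (m + l)"
    by (rule residue_mod[symmetric]) simp
  also have "\<dots> = ?p ^ (m + l) * (a * b) mod ?p ^ (m + l)"
    unfolding residue_mult ab by (rule mod_prime_power_Suc)
  finally show "residue (x * y) (m + l) = 0" by simp
qed

instance padic_int :: (prime_card) idom
proof
  fix x y :: "'a padic_int"
  assume "x \<noteq> 0" "y \<noteq> 0"
  then show "x * y \<noteq> 0" using padic_int_val_mult_aux(2) by fastforce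
qed

lemma padic_int_val_mult:
  fixes x y :: "'p :: prime_card padic_int"
  assumes "x \<noteq> 0" "y \<noteq> 0"
  shows "padic_int_val (x * y) = padic_int_val x + padic_int_val y"
  using padic_int_val_mult_aux[OF assms] assms
  by (simp add: residue_eq_0_iff)

type_synonym 'p padic = "'p padic_int fract"

definition padic_int_norm :: "'p :: prime_card padic_int \<Rightarrow> real" where
  "padic_int_norm x = (if x = 0 then 0 else real CARD('p) powi (- int (padic_int_val x)))"

lemma padic_int_norm_mult:
  "padic_int_norm (x * y) = padic_int_norm x * padic_int_norm (y :: 'p :: prime_card padic_int)"
  by (simp add: padic_int_norm_def padic_int_val_mult power_int_add[symmetric])

lemma padic_int_norm_eq_0_iff [simp]:
  "padic_int_norm (x :: 'p :: prime_card padic_int) = 0 \<longleftrightarrow> x = 0"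
  by (simp add: padic_int_norm_def)

definition padic_norm :: "'p :: prime_card padic \<Rightarrow> real" where
  "padic_norm q = (THE r. \<exists>a b. b \<noteq> 0 \<and> q = Fract a b \<and> r = padic_int_norm a / padic_int_norm b)"

lemma padic_norm_Fract:
  fixes a b :: "'p :: prime_card padic_int"
  assumes "b \<noteq> 0"
  shows "padic_norm (Fract a b) = padic_int_norm a / padic_int_norm b"
  unfolding padic_norm_def
proof (rule the_equality)
  fix r
  assume "\<exists>c d. d \<noteq> 0 \<and> Fract a b = Fract c d \<and> r = padic_int_norm c / padic_int_norm d"
  then obtain c d where d: "d \<noteq> 0" "a * d = c * b" and r: "r = padic_int_norm c / padic_int_norm d"
    using assms by (auto simp: eq_fract)
  from d(2) have "padic_int_norm a * padic_int_norm d = padic_int_norm c * padic_int_norm b"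
    by (simp flip: padic_int_norm_mult)
  with assms d(1) show "r = padic_int_norm a / padic_int_norm b"
    by (simp add: r frac_eq_eq)
qed (use assms in blast)

definition padic_cong :: "'p :: prime_card padic \<Rightarrow> 'p padic \<Rightarrow> nat \<Rightarrow> bool" where
  "padic_cong a b s \<longleftrightarrow> padic_norm (a - b) \<le> real CARD('p) powi (- int s)"

lemma padic_norm_to_fract:
  "padic_norm (to_fract x) = padic_int_norm (x :: 'p :: prime_card padic_int)"
proof -
  have "padic_int_norm (1 :: 'p padic_int) * padic_int_norm (1 :: 'p padic_int)
      = padic_int_norm (1 :: 'p padic_int)"
    by (simp flip: padic_int_norm_mult)
  then have "padic_int_norm (1 :: 'p padic_int) = 1" by simp
  then show ?thesis
    by (simp add: to_fract_def padic_norm_Fract)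
qed

lemma padic_norm_to_fract_le_iff:
  "padic_norm (to_fract x) \<le> real CARD('p) powi (- int s) \<longleftrightarrow>
    residue (x :: 'p :: prime_card padic_int) s = 0"
proof -
  have "1 < real CARD('p)"
    using prime_gt_1_nat[OF prime_card[where 'a = 'p]] by simp
  then show ?thesis
    by (auto simp: padic_norm_to_fract padic_int_norm_def residue_eq_0_iff
        power_int_minus)
qed

lemma padic_cong_to_fract_iff:
  "padic_cong (to_fract x) (to_fract y) s \<longleftrightarrow>
    residue x s = residue (y :: 'p :: prime_card padic_int) s"
proof -
  have "padic_cong (to_fract x) (to_fract y) s \<longleftrightarrow> residue (x - y) s = 0"
    unfolding padic_cong_def padic_norm_to_fract_le_iff[symmetric] by simp
  also have "\<dots> \<longleftrightarrow> residue x s mod int CARD('p) ^ s = residue y s mod int CARD('p) ^ s"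
    by (simp add: residue_diff mod_eq_dvd_iff mod_eq_0_iff_dvd)
  finally show ?thesis by (simp add: residue_bounds)
qed

text \<open>
  \<open>has_derivative_mod k f N f'\<close>: the function \<open>f'\<close> is a derivative of \<open>f\<close> modulo \<open>p\<^sup>k\<close>,
  with \<open>N\<close> as a uniform bound.
\<close>

definition has_derivative_mod ::
  "nat \<Rightarrow> ('p :: prime_card padic_int \<Rightarrow> 'p padic_int) \<Rightarrow> nat \<Rightarrow> ('p padic_int \<Rightarrow> 'p padic) \<Rightarrow> bool"
where
  "has_derivative_mod k f N f' \<longleftrightarrow>
    (\<forall>K\<ge>N. \<forall>u h. padic_norm (to_fract h) \<le> real CARD('p) powi (- int K) \<longrightarrow>
      padic_cong (to_fract (f (u + h))) (to_fract (f u) + to_fract h * f' u) (k + K))"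

definition uniformly_differentiable_mod ::
  "nat \<Rightarrow> ('p :: prime_card padic_int \<Rightarrow> 'p padic_int) \<Rightarrow> bool" where
  "uniformly_differentiable_mod k f \<longleftrightarrow> (\<exists>N f'. has_derivative_mod k f N f')"

definition N_mod :: "nat \<Rightarrow> ('p :: prime_card padic_int \<Rightarrow> 'p padic_int) \<Rightarrow> nat" where
  "N_mod k f = (LEAST N. \<exists>f'. has_derivative_mod k f N f')"

definition integer_valued_derivative_mod ::
  "nat \<Rightarrow> ('p :: prime_card padic_int \<Rightarrow> 'p padic_int) \<Rightarrow> bool" where
  "integer_valued_derivative_mod k f \<longleftrightarrow>
    (\<exists>N f'. has_derivative_mod k f N f' \<and> (\<forall>u. f' u \<in> range to_fract))"

definition reduction_mod ::
  "nat \<Rightarrow> ('p :: prime_card padic_int \<Rightarrow> 'p padic_int) \<Rightarrow> nat \<Rightarrow> nat" where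
  "reduction_mod k f x = nat (residue (f (of_nat x)) k)"

definition transitive_mod ::
  "nat \<Rightarrow> ('p :: prime_card padic_int \<Rightarrow> 'p padic_int) \<Rightarrow> bool" where
  "transitive_mod k f \<longleftrightarrow>
    bij_betw (reduction_mod k f) {..<CARD('p) ^ k} {..<CARD('p) ^ k} \<and>
    cyclic_on (reduction_mod k f) {..<CARD('p) ^ k}"

definition asymptotically_ergodic ::
  "('p :: prime_card padic_int \<Rightarrow> 'p padic_int) \<Rightarrow> bool" where
  "asymptotically_ergodic f \<longleftrightarrow> (\<exists>k\<^sub>0. \<forall>k\<ge>k\<^sub>0. transitive_mod k f)"

end

theory Submission
  imports Defs "HOL-Number_Theory.Residues"
begin

text \<open>
  Let \<open>N\<close> be the uniform bound \<open>N\<^sub>2(f)\<close>. For \<open>k \<ge> N\<close> the function \<open>f\<close> acts on \<open>\<int>/p\<^sup>k\<close>, and it is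
  transitive there iff \<open>f\<^sup>i 0 \<equiv> 0 (mod p\<^sup>k)\<close> holds exactly for \<open>p\<^sup>k dvd i\<close>. Let \<open>M \<ge> N\<close>, let \<open>g\<close> be the
  \<open>p\<^sup>M\<close>-fold iterate of \<open>f\<close> and \<open>e\<close> its derivative at \<open>0\<close>. If \<open>f\<close> is transitive modulo \<open>p\<^sup>M\<close>, then \<open>g\<close>
  maps \<open>p\<^sup>M\<int>\<^sub>p\<close> to itself and is affine there modulo \<open>p\<^bsup>M+2\<^esup>\<close>, hence
  \<open>g\<^sup>n 0 \<equiv> (1 + e + \<dots> + e\<^bsup>n-1\<^esup>) g 0\<close>. Therefore \<open>f\<close> is transitive modulo \<open>p\<^bsup>M+1\<^esup>\<close> iff \<open>g 0\<close> is nonzero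
  modulo \<open>p\<^bsup>M+1\<^esup>\<close> and \<open>e \<equiv> 1 (mod p)\<close>. This criterion passes from \<open>M\<close> to \<open>M + 1\<close> whenever the
  geometric sum of length \<open>p\<close> is \<open>p\<close> modulo \<open>p\<^sup>2\<close>: then \<open>g\<^sup>p 0 \<equiv> p g 0 (mod p\<^bsup>M+2\<^esup>)\<close>, while the
  derivative of \<open>g\<^sup>p\<close> at \<open>0\<close> is congruent to \<open>e\<^sup>p\<close>. For odd \<open>p\<close> the sum has this value as soon as
  \<open>e \<equiv> 1 (mod p)\<close>. For \<open>p = 2\<close> one more level is needed: then \<open>e \<equiv> d\<^sup>p (mod p\<^sup>2)\<close> for some
  \<open>d \<equiv> 1 (mod p)\<close>, and thus \<open>e \<equiv> 1 (mod p\<^sup>2)\<close>.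
\<close>

subsection \<open>Congruences and geometric sums in commutative rings\<close>

text \<open>
  The library's \<^const>\<open>cong\<close> is confined to unique Euclidean semirings, a class that the
  \<open>p\<close>-adic integers are not known to instantiate here.
\<close>

definition ring_cong :: "'a :: comm_ring_1 \<Rightarrow> 'a \<Rightarrow> 'a \<Rightarrow> bool"
    (\<open>(\<open>indent=1 notation=\<open>mixfix ring_cong\<close>\<close>[_ \<equiv> _] '(' mod _'))\<close>)
  where "[x \<equiv> y] (mod m) \<longleftrightarrow> m dvd x - y"

lemma ring_cong_0_iff: "[x \<equiv> 0] (mod m) \<longleftrightarrow> m dvd x"
  by (simp add: ring_cong_def)

lemma ring_cong_refl [simp]: "[x \<equiv> x] (mod m)"
  by (simp add: ring_cong_def)

lemma ring_cong_sym: "[x \<equiv> y] (mod m) \<Longrightarrow> [y \<equiv> x] (mod m)"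
  unfolding ring_cong_def by (metis dvd_minus_iff minus_diff_eq)

lemma ring_cong_trans [trans]:
  assumes "[x \<equiv> y] (mod m)" and "[y \<equiv> z] (mod m)"
  shows "[x \<equiv> z] (mod m)"
  using dvd_add[OF assms[unfolded ring_cong_def]] by (simp add: ring_cong_def)

lemma ring_cong_add:
  assumes "[x \<equiv> x'] (mod m)" and "[y \<equiv> y'] (mod m)"
  shows "[x + y \<equiv> x' + y'] (mod m)"
  using dvd_add[OF assms[unfolded ring_cong_def]] by (simp add: ring_cong_def algebra_simps)

lemma ring_cong_mult:
  assumes "[x \<equiv> x'] (mod m)" and "[y \<equiv> y'] (mod m)"
  shows "[x * y \<equiv> x' * y'] (mod m)"
proof -
  have "m dvd (x - x') * y + x' * (y - y')"
    using assms by (simp add: ring_cong_def)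
  then show ?thesis by (simp add: ring_cong_def algebra_simps)
qed

lemma ring_cong_power: "[x \<equiv> y] (mod m) \<Longrightarrow> [x ^ n \<equiv> y ^ n] (mod m)"
  by (induction n) (simp_all add: ring_cong_mult)

lemma ring_cong_sum:
  "(\<And>i. i \<in> A \<Longrightarrow> [f i \<equiv> g i] (mod m)) \<Longrightarrow> [sum f A \<equiv> sum g A] (mod m)"
  by (induction A rule: infinite_finite_induct) (simp_all add: ring_cong_add)

lemma ring_cong_prod:
  "(\<And>i. i \<in> A \<Longrightarrow> [f i \<equiv> g i] (mod m)) \<Longrightarrow> [prod f A \<equiv> prod g A] (mod m)"
  by (induction A rule: infinite_finite_induct) (simp_all add: ring_cong_mult)

lemma ring_cong_dvd_modulus: "[x \<equiv> y] (mod m) \<Longrightarrow> d dvd m \<Longrightarrow> [x \<equiv> y] (mod d)"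
  unfolding ring_cong_def by (rule dvd_trans)

lemma ring_cong_dvd_iff:
  assumes "[x \<equiv> y] (mod m)"
  shows "m dvd x \<longleftrightarrow> m dvd y"
  using dvd_add_right_iff[of m "x - y" y] assms by (simp add: ring_cong_def)

lemma ring_cong_mult_moduli:
  assumes "m dvd x" and "[y \<equiv> z] (mod n)"
  shows "[x * y \<equiv> x * z] (mod m * n)"
  using mult_dvd_mono[OF assms[unfolded ring_cong_def]]
  by (simp add: ring_cong_def right_diff_distrib)

lemma sum_powers_cong:
  assumes "[x \<equiv> 1] (mod m)"
  shows "[(\<Sum>i<n. x ^ i) \<equiv> of_nat n] (mod m)"
proof -
  have "[(\<Sum>i<n. x ^ i) \<equiv> (\<Sum>i<n. 1 ^ i)] (mod m)"
    by (intro ring_cong_sum ring_cong_power assms)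
  then show ?thesis by simp
qed

lemma power_cong_1_square_modulus:
  assumes "[x \<equiv> 1] (mod of_nat n)"
  shows "[x ^ n \<equiv> 1] (mod of_nat n ^ 2)"
proof -
  have "of_nat n dvd (\<Sum>i<n. x ^ i)"
    using ring_cong_dvd_iff[OF sum_powers_cong[OF assms]] by simp
  then show ?thesis
    using assms by (simp add: ring_cong_def power_diff_1_eq power2_eq_square mult_dvd_mono)
qed

lemma power_cong_linear:
  fixes x :: "'a :: comm_ring_1"
  shows "[x ^ n \<equiv> 1 + of_nat n * (x - 1)] (mod (x - 1) ^ 2)"
proof (induction n)
  case (Suc n)
  have "[x * x ^ n \<equiv> x * (1 + of_nat n * (x - 1))] (mod (x - 1) ^ 2)"
    by (intro ring_cong_mult ring_cong_refl Suc)
  moreover have "x * (1 + of_nat n * (x - 1)) - (1 + of_nat (Suc n) * (x - 1)) =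
      of_nat n * (x - 1) ^ 2"
    by (simp add: power2_eq_square algebra_simps)
  then have "[x * (1 + of_nat n * (x - 1)) \<equiv> 1 + of_nat (Suc n) * (x - 1)] (mod (x - 1) ^ 2)"
    by (simp add: ring_cong_def)
  ultimately show ?case
    unfolding power_Suc by (rule ring_cong_trans)
qed simp

lemma odd_dvd_sum_lessThan:
  fixes n :: nat
  assumes "odd n"
  shows "n dvd \<Sum>{..<n}"
proof -
  obtain k where k: "n = 2 * k + 1" using assms by (rule oddE)
  have "\<Sum>{..<n} = n * k"
    using gauss_sum_nat[of "2 * k"] by (simp add: k lessThan_Suc_atMost atMost_atLeast0)
  then show ?thesis by simp
qed

lemma sum_powers_cong_square_modulus:
  fixes x :: "'a :: comm_ring_1"
  assumes "odd n" and x: "[x \<equiv> 1] (mod of_nat n)"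
  shows "[(\<Sum>i<n. x ^ i) \<equiv> of_nat n] (mod of_nat n ^ 2)"
proof -
  have dvd_x_minus_1: "of_nat n dvd x - 1" using x by (simp add: ring_cong_def)
  then have "[x ^ i \<equiv> 1 + of_nat i * (x - 1)] (mod of_nat n ^ 2)" for i
    by (intro ring_cong_dvd_modulus[OF power_cong_linear] dvd_power_same)
  then have "[(\<Sum>i<n. x ^ i) \<equiv> (\<Sum>i<n. 1 + of_nat i * (x - 1))] (mod of_nat n ^ 2)"
    by (rule ring_cong_sum)
  also have "(\<Sum>i<n. 1 + of_nat i * (x - 1)) = of_nat n + of_nat (\<Sum>{..<n}) * (x - 1)"
    by (simp add: sum.distrib sum_distrib_right)
  also have "[\<dots> \<equiv> of_nat n + 0] (mod of_nat n ^ 2)"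
  proof (rule ring_cong_add[OF ring_cong_refl])
    have "of_nat n dvd (of_nat (\<Sum>{..<n}) :: 'a)"
      using odd_dvd_sum_lessThan[OF assms(1)] by (metis dvd_def of_nat_mult)
    then show "[of_nat (\<Sum>{..<n}) * (x - 1) \<equiv> 0] (mod of_nat n ^ 2)"
      unfolding ring_cong_0_iff power2_eq_square using dvd_x_minus_1 by (rule mult_dvd_mono)
  qed
  finally show ?thesis by simp
qed

lemma power_prime_cong_self:
  fixes p a :: nat
  assumes p: "prime p"
  shows "[a ^ p = a] (mod p)"
proof (cases "p dvd a")
  case True
  then have "[a ^ p = 0 ^ p] (mod p)"
    by (intro cong_pow) (simp add: cong_0_iff)
  also have "0 ^ p = (0 :: nat)"
    using p by (simp add: prime_gt_0_nat zero_power)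
  also have "[0 = a] (mod p)"
    using True by (simp add: cong_sym_eq[of 0] cong_0_iff)
  finally show ?thesis .
next
  case False
  then have "[a * a ^ (p - 1) = a * 1] (mod p)"
    using p by (intro cong_scalar_left fermat_theorem)
  then show ?thesis
    using p by (simp add: prime_gt_0_nat flip: power_eq_if power_Suc)
qed

subsection \<open>Orbits of self-maps of finite sets\<close>

lemma funpow_eq_self_iff_card_orbit_dvd:
  assumes self: "x \<in> orbit F x"
  shows "(F ^^ i) x = x \<longleftrightarrow> card (orbit F x) dvd i"
proof -
  let ?d = "funpow_dist1 F x x"
  have "card (orbit F x) = ?d"
    using orbit_conv_funpow_dist1[OF self] inj_on_funpow_dist1[OF self]
    by (simp add: card_image)
  moreover have "(F ^^ i) x = (F ^^ (i mod ?d)) x"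
    using funpow_dist1_prop[OF self] by (simp only: funpow_mod_eq)
  moreover have "(F ^^ (i mod ?d)) x \<noteq> x" if "0 < i mod ?d"
    using that by (intro funpow_dist1_least) simp_all
  ultimately show ?thesis
    by (cases "i mod ?d = 0") (auto simp: dvd_eq_mod_eq_0 simp del: funpow.simps)
qed

lemma orbit_subset_invariant:
  assumes "x \<in> A" and "F ` A \<subseteq> A"
  shows "orbit F x \<subseteq> A"
proof
  fix y assume "y \<in> orbit F x"
  then show "y \<in> A" by induction (use assms in auto)
qed

lemma orbit_eq_iff_return_times:
  assumes A: "finite A" "x \<in> A" and F: "F ` A \<subseteq> A"
  shows "orbit F x = A \<longleftrightarrow> (\<forall>i. (F ^^ i) x = x \<longleftrightarrow> card A dvd i)"
proof
  assume "orbit F x = A"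
  with A(2) show "\<forall>i. (F ^^ i) x = x \<longleftrightarrow> card A dvd i"
    using funpow_eq_self_iff_card_orbit_dvd[of x F] by simp
next
  assume return: "\<forall>i. (F ^^ i) x = x \<longleftrightarrow> card A dvd i"
  have "0 < card A" using A card_gt_0_iff by blast
  moreover have "(F ^^ card A) x = x" using return by simp
  ultimately have self: "x \<in> orbit F x"
    unfolding orbit_altdef by (metis (mono_tags, lifting) mem_Collect_eq)
  have "card (orbit F x) dvd i \<longleftrightarrow> card A dvd i" for i
    using return funpow_eq_self_iff_card_orbit_dvd[OF self] by simp
  then have "card (orbit F x) = card A" by (meson dvd_antisym dvd_refl)
  moreover have "orbit F x \<subseteq> A" using A(2) F by (rule orbit_subset_invariant)
  ultimately show "orbit F x = A" using A(1) by (simp add: card_subset_eq)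
qed

lemma bij_betw_cyclic_on_iff_orbit:
  assumes "finite A" and "x \<in> A"
  shows "bij_betw F A A \<and> cyclic_on F A \<longleftrightarrow> orbit F x = A"
proof
  assume "bij_betw F A A \<and> cyclic_on F A"
  then show "orbit F x = A" using assms(2) orbit_cyclic_eq3 by metis
next
  assume "orbit F x = A"
  then have "cyclic_on F A" using assms(2) by (auto simp: cyclic_on_def)
  moreover have "F ` A = A"
  proof
    show "F ` A \<subseteq> A" using \<open>orbit F x = A\<close> by (auto intro: orbit.step)
    show "A \<subseteq> F ` A"
    proof
      fix y assume "y \<in> A"
      then have "y \<in> orbit F x" using \<open>orbit F x = A\<close> by simp
      then show "y \<in> F ` A" by cases (use \<open>orbit F x = A\<close> assms(2) in auto)
    qed
  qed
  then have "bij_betw F A A"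
    using assms(1) by (metis bij_betw_def eq_card_imp_inj_on)
  ultimately show "bij_betw F A A \<and> cyclic_on F A" by simp
qed

subsection \<open>Divisibility in the \<open>p\<close>-adic integers\<close>

abbreviation padic_p :: "'p :: prime_card padic_int" where
  "padic_p \<equiv> of_nat CARD('p)"

lift_definition padic_shift :: "nat \<Rightarrow> 'p :: prime_card padic_int \<Rightarrow> 'p padic_int"
  is "\<lambda>s x n. x (n + s) div int CARD('p) ^ s"
proof (intro allI conjI)
  fix s n and x :: "nat \<Rightarrow> int"
  let ?p = "int CARD('p)"
  assume x: "\<And>n. x n \<in> {0..<?p ^ n} \<and> x (Suc n) mod ?p ^ n = x n"
  have "x (n + s) = x (Suc (n + s)) mod (?p ^ s * ?p ^ n)"
    using x by (simp add: add.commute flip: power_add)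
  also have "\<dots> div ?p ^ s = x (Suc n + s) div ?p ^ s mod ?p ^ n"
    by (simp add: zmod_zmult2_eq)
  finally show coherent: "x (Suc n + s) div ?p ^ s mod ?p ^ n = x (n + s) div ?p ^ s" by simp
  show "x (n + s) div ?p ^ s \<in> {0..<?p ^ n}"
    unfolding coherent[symmetric] by simp
qed

lemma mult_padic_shift:
  fixes x :: "'p :: prime_card padic_int"
  assumes "residue x s = 0"
  shows "padic_p ^ s * padic_shift s x = x"
proof (rule padic_int_eqI)
  fix n
  let ?p = "int CARD('p)"
  have "residue (padic_p ^ s * padic_shift s x) n
      = residue (of_nat (CARD('p) ^ s) * padic_shift s x) n"
    by simp
  also have "\<dots> = ?p ^ s * (residue x (n + s) div ?p ^ s) mod ?p ^ n"
    unfolding residue_mult residue_of_nat padic_shift.rep_eq by (simp add: mod_mult_left_eq)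
  also have "?p ^ s * (residue x (n + s) div ?p ^ s) = residue x (n + s)"
    using assms residue_mod[of s "n + s" x] by auto
  also have "residue x (n + s) mod ?p ^ n = residue x n"
    by (rule residue_mod) simp
  finally show "residue (padic_p ^ s * padic_shift s x) n = residue x n" .
qed

lemma residue_eq_0_iff_dvd:
  "residue (x :: 'p :: prime_card padic_int) s = 0 \<longleftrightarrow> padic_p ^ s dvd x"
proof
  assume "residue x s = 0"
  then have "x = padic_p ^ s * padic_shift s x" by (simp add: mult_padic_shift)
  then show "padic_p ^ s dvd x" by (rule dvdI)
next
  assume "padic_p ^ s dvd x"
  then obtain y where y: "x = of_nat (CARD('p) ^ s) * y" by (auto elim: dvdE)
  show "residue x s = 0" by (simp only: y residue_mult residue_of_nat) simp
qed

lemma residue_eq_iff_ring_cong: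
  "residue x s = residue y s \<longleftrightarrow> [x \<equiv> y] (mod (padic_p :: 'p :: prime_card padic_int) ^ s)"
proof -
  have "residue x s = residue y s \<longleftrightarrow> padic_cong (to_fract x) (to_fract y) s"
    by (simp add: padic_cong_to_fract_iff)
  also have "\<dots> \<longleftrightarrow> residue (x - y) s = 0"
    unfolding padic_cong_def padic_norm_to_fract_le_iff[symmetric] by simp
  finally show ?thesis by (simp add: ring_cong_def residue_eq_0_iff_dvd)
qed

lemma of_nat_residue_cong:
  fixes x :: "'p :: prime_card padic_int"
  shows "[of_nat (nat (residue x s)) \<equiv> x] (mod padic_p ^ s)"
  unfolding residue_eq_iff_ring_cong[symmetric] residue_of_nat
  using residue_bounds[of x s] by simp

lemma padic_int_cong_of_nat_iff:
  "[of_nat a \<equiv> of_nat b] (mod (padic_p :: 'p :: prime_card padic_int) ^ s) \<longleftrightarrow>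
    [a = b] (mod CARD('p) ^ s)"
  unfolding residue_eq_iff_ring_cong[symmetric] residue_of_nat cong_def
  by (simp flip: of_nat_power of_nat_mod)

lemma padic_p_power_dvd_of_nat_iff:
  "padic_p ^ s dvd (of_nat a :: 'p :: prime_card padic_int) \<longleftrightarrow> CARD('p) ^ s dvd a"
  using padic_int_cong_of_nat_iff[of a 0 s] by (simp add: ring_cong_0_iff cong_0_iff)

lemma padic_p_power_dvd_power_iff:
  "(padic_p :: 'p :: prime_card padic_int) ^ m dvd padic_p ^ n \<longleftrightarrow> m \<le> n"
proof -
  have "1 < CARD('p)" by (rule prime_gt_1_nat[OF prime_card])
  then show ?thesis
    using padic_p_power_dvd_of_nat_iff[where 'p = 'p, of m "CARD('p) ^ n"]
    by (simp add: dvd_power_iff_le)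
qed

lemma padic_p_nonzero [simp]: "(padic_p :: 'p :: prime_card padic_int) \<noteq> 0"
proof
  assume "(padic_p :: 'p padic_int) = 0"
  then show False using padic_p_power_dvd_power_iff[where 'p = 'p, of 2 1] by simp
qed

lemma padic_p_power_dvd_iff_le_val:
  fixes x :: "'p :: prime_card padic_int"
  assumes "x \<noteq> 0"
  shows "padic_p ^ n dvd x \<longleftrightarrow> n \<le> padic_int_val x"
  using residue_eq_0_iff[OF assms] by (simp add: residue_eq_0_iff_dvd)

lemma padic_int_val_p_power: "padic_int_val ((padic_p :: 'p :: prime_card padic_int) ^ n) = n"
proof -
  have "m \<le> padic_int_val ((padic_p :: 'p padic_int) ^ n) \<longleftrightarrow> m \<le> n" for m
    using padic_p_power_dvd_iff_le_val[where 'p = 'p, of "padic_p ^ n" m]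
    by (simp add: padic_p_power_dvd_power_iff)
  then show ?thesis by (meson order_antisym order_refl)
qed

lemma prime_elem_padic_p: "prime_elem (padic_p :: 'p :: prime_card padic_int)"
proof (rule prime_elemI)
  show "\<not> (padic_p :: 'p padic_int) dvd 1"
    using padic_p_power_dvd_power_iff[where 'p = 'p, of 1 0] by simp
next
  fix x y :: "'p padic_int"
  assume dvd_xy: "padic_p dvd x * y"
  show "padic_p dvd x \<or> padic_p dvd y"
  proof (cases "x = 0 \<or> y = 0")
    case False
    then show ?thesis
      using dvd_xy padic_p_power_dvd_iff_le_val[of x 1] padic_p_power_dvd_iff_le_val[of y 1]
        padic_p_power_dvd_iff_le_val[of "x * y" 1] by (auto simp: padic_int_val_mult)
  qed auto
qed simp

lemma padic_int_fermat:
  fixes x :: "'p :: prime_card padic_int"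
  shows "[x ^ CARD('p) \<equiv> x] (mod padic_p)"
proof -
  let ?p = "CARD('p)"
  obtain a :: nat where a: "[of_nat a \<equiv> x] (mod padic_p)"
    using of_nat_residue_cong[of x 1] by auto
  have "[x ^ ?p \<equiv> of_nat (a ^ ?p)] (mod padic_p)"
    unfolding of_nat_power by (intro ring_cong_power ring_cong_sym[OF a])
  also have "[of_nat (a ^ ?p) \<equiv> of_nat a] (mod (padic_p :: 'p padic_int))"
    using padic_int_cong_of_nat_iff[where 'p = 'p, of "a ^ ?p" a 1]
      power_prime_cong_self[OF prime_card[where 'a = 'p]] by simp
  also note a
  finally show ?thesis .
qed

lemma padic_p_dvd_mult_sum_powers_iff:
  fixes b x :: "'p :: prime_card padic_int"
  shows "(\<forall>n. padic_p dvd b * (\<Sum>i<n. x ^ i) \<longleftrightarrow> CARD('p) dvd n) \<longleftrightarrow>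
    \<not> padic_p dvd b \<and> [x \<equiv> 1] (mod padic_p)"
proof (intro iffI conjI)
  assume dvd_iff: "\<forall>n. padic_p dvd b * (\<Sum>i<n. x ^ i) \<longleftrightarrow> CARD('p) dvd n"
  from dvd_iff[rule_format, of 1] show not_dvd_b: "\<not> padic_p dvd b"
    using prime_gt_1_nat[OF prime_card[where 'a = 'p]] by simp
  from dvd_iff have "padic_p dvd b * (\<Sum>i<CARD('p). x ^ i)" by simp
  then have "padic_p dvd (\<Sum>i<CARD('p). x ^ i)"
    using not_dvd_b by (simp add: prime_elem_dvd_mult_iff[OF prime_elem_padic_p])
  then have "padic_p dvd x ^ CARD('p) - 1"
    by (simp add: power_diff_1_eq)
  then have "[x ^ CARD('p) \<equiv> 1] (mod padic_p)"
    by (simp add: ring_cong_def)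
  with ring_cong_sym[OF padic_int_fermat] show "[x \<equiv> 1] (mod padic_p)"
    by (rule ring_cong_trans)
next
  assume conds: "\<not> padic_p dvd b \<and> [x \<equiv> 1] (mod padic_p)"
  show "\<forall>n. padic_p dvd b * (\<Sum>i<n. x ^ i) \<longleftrightarrow> CARD('p) dvd n"
  proof
    fix n
    have "padic_p dvd b * (\<Sum>i<n. x ^ i) \<longleftrightarrow> padic_p dvd (\<Sum>i<n. x ^ i)"
      using conds by (simp add: prime_elem_dvd_mult_iff[OF prime_elem_padic_p])
    also have "\<dots> \<longleftrightarrow> padic_p dvd (of_nat n :: 'p padic_int)"
      using conds by (intro ring_cong_dvd_iff sum_powers_cong) simp
    also have "\<dots> \<longleftrightarrow> CARD('p) dvd n"
      using padic_p_power_dvd_of_nat_iff[where 'p = 'p, of 1 n] by simp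
    finally show "padic_p dvd b * (\<Sum>i<n. x ^ i) \<longleftrightarrow> CARD('p) dvd n" .
  qed
qed

subsection \<open>The \<open>p\<close>-adic norm\<close>

lemma padic_int_norm_nonneg: "0 \<le> padic_int_norm (x :: 'p :: prime_card padic_int)"
  by (simp add: padic_int_norm_def)

lemma padic_int_norm_le_iff_dvd:
  "padic_int_norm x \<le> real CARD('p) powi (- int s) \<longleftrightarrow>
    padic_p ^ s dvd (x :: 'p :: prime_card padic_int)"
  by (simp only: padic_norm_to_fract[symmetric] padic_norm_to_fract_le_iff residue_eq_0_iff_dvd)

lemma padic_int_norm_add:
  "padic_int_norm (x + y) \<le>
    max (padic_int_norm x) (padic_int_norm (y :: 'p :: prime_card padic_int))"
proof (cases "x = 0 \<or> y = 0")
  case True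
  then show ?thesis by (auto simp: le_max_iff_disj)
next
  case False
  define s where "s = min (padic_int_val x) (padic_int_val y)"
  have "padic_p ^ s dvd x" and "padic_p ^ s dvd y"
    using False by (simp_all add: padic_p_power_dvd_iff_le_val s_def)
  then have "padic_p ^ s dvd x + y" by (rule dvd_add)
  then have "padic_int_norm (x + y) \<le> real CARD('p) powi (- int s)"
    by (simp only: padic_int_norm_le_iff_dvd)
  also have "\<dots> \<le> max (padic_int_norm x) (padic_int_norm y)"
    using False by (auto simp: padic_int_norm_def s_def min_def)
  finally show ?thesis .
qed

lemma padic_int_norm_minus:
  "padic_int_norm (- x) = padic_int_norm (x :: 'p :: prime_card padic_int)"
proof -
  have "padic_int_norm (- x) * padic_int_norm (- x) = padic_int_norm x * padic_int_norm x"
    by (simp flip: padic_int_norm_mult)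
  then show ?thesis
    by (metis padic_int_norm_nonneg power2_eq_iff_nonneg power2_eq_square)
qed

lemma padic_norm_mult:
  "padic_norm (q * r) = padic_norm q * padic_norm (r :: 'p :: prime_card padic)"
  by (cases q; cases r) (simp add: padic_norm_Fract padic_int_norm_mult)

lemma padic_norm_nonneg: "0 \<le> padic_norm (q :: 'p :: prime_card padic)"
  by (cases q) (simp add: padic_norm_Fract padic_int_norm_nonneg)

lemma padic_norm_minus: "padic_norm (- q) = padic_norm (q :: 'p :: prime_card padic)"
  by (cases q) (simp add: padic_norm_Fract padic_int_norm_minus)

lemma padic_norm_add:
  "padic_norm (q + r) \<le> max (padic_norm q) (padic_norm (r :: 'p :: prime_card padic))"
proof -
  obtain a b where q: "q = Fract a b" "b \<noteq> 0" by (cases q) auto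
  obtain c d where r: "r = Fract c d" "d \<noteq> 0" by (cases r) auto
  have pos: "0 < padic_int_norm (b * d)"
    using q r padic_int_norm_nonneg[of "b * d"] by (simp add: less_le)
  have "padic_norm (q + r) = padic_int_norm (a * d + c * b) / padic_int_norm (b * d)"
    using q r by (simp add: padic_norm_Fract)
  also have "\<dots> \<le> max (padic_int_norm (a * d)) (padic_int_norm (c * b)) / padic_int_norm (b * d)"
    using pos by (simp add: divide_right_mono padic_int_norm_add)
  also have "\<dots> = max (padic_int_norm (a * d) / padic_int_norm (b * d))
      (padic_int_norm (c * b) / padic_int_norm (b * d))"
    using pos by (simp add: max_def divide_le_cancel)
  also have "\<dots> = max (padic_norm q) (padic_norm r)"
    using q r by (simp add: padic_norm_Fract padic_int_norm_mult)
  finally show ?thesis .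
qed

lemma padic_norm_p_power:
  "padic_norm (to_fract ((padic_p :: 'p :: prime_card padic_int) ^ n)) =
    real CARD('p) powi (- int n)"
  unfolding padic_norm_to_fract padic_int_norm_def padic_int_val_p_power by simp

lemma padic_cong_sym: "padic_cong q r s \<Longrightarrow> padic_cong r q s"
  unfolding padic_cong_def using padic_norm_minus[of "q - r"] by simp

lemma padic_cong_trans [trans]: "padic_cong q r s \<Longrightarrow> padic_cong r t s \<Longrightarrow> padic_cong q t s"
  unfolding padic_cong_def using padic_norm_add[of "q - r" "r - t"] by simp

lemma padic_cong_add_left_iff: "padic_cong (t + q) (t + r) s \<longleftrightarrow> padic_cong q r s"
  by (simp add: padic_cong_def)

lemma padic_cong_mult_left:
  fixes q r t :: "'p :: prime_card padic"
  assumes "padic_norm t \<le> real CARD('p) powi (- int n)" and "padic_cong q r s"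
  shows "padic_cong (t * q) (t * r) (s + n)"
proof -
  have "padic_norm (t * (q - r)) \<le> real CARD('p) powi (- int n) * real CARD('p) powi (- int s)"
    unfolding padic_norm_mult
    using assms by (intro mult_mono') (simp_all add: padic_cong_def padic_norm_nonneg)
  also have "\<dots> = real CARD('p) powi (- int n + - int s)"
    by (rule power_int_add[symmetric]) simp
  finally show ?thesis
    by (simp add: padic_cong_def right_diff_distrib add.commute)
qed

lemma padic_cong_p_power_mult_left_iff:
  fixes q r :: "'p :: prime_card padic"
  shows "padic_cong (to_fract (padic_p ^ n) * q) (to_fract (padic_p ^ n) * r) (s + n) \<longleftrightarrow>
    padic_cong q r s"
proof -
  have "padic_norm (to_fract (padic_p ^ n) * q - to_fract (padic_p ^ n) * r) =
      real CARD('p) powi (- int n) * padic_norm (q - r)"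
    by (simp only: padic_norm_mult padic_norm_p_power flip: right_diff_distrib)
  moreover have "real CARD('p) powi (- int (s + n)) =
      real CARD('p) powi (- int n) * real CARD('p) powi (- int s)"
    using power_int_add[of "real CARD('p)" "- int n" "- int s"] by (simp add: add.commute)
  ultimately show ?thesis
    by (simp add: padic_cong_def)
qed

subsection \<open>Derivatives modulo \<open>p\<^sup>k\<close>\<close>

lemma has_derivative_mod_unique:
  fixes f :: "'p :: prime_card padic_int \<Rightarrow> 'p padic_int"
  assumes f': "has_derivative_mod k f N f'" and g': "has_derivative_mod k f N' g'"
  shows "padic_cong (f' u) (g' u) k"
proof -
  define L where "L = max N N'"
  let ?d = "padic_p ^ L :: 'p padic_int"
  have L: "padic_norm (to_fract ?d) \<le> real CARD('p) powi (- int L)"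
    by (simp only: padic_norm_p_power)
  have "padic_cong (to_fract (f (u + ?d))) (to_fract (f u) + to_fract ?d * f' u) (k + L)"
    using f' L unfolding has_derivative_mod_def L_def by (meson max.cobounded1)
  then have "padic_cong (to_fract (f u) + to_fract ?d * f' u) (to_fract (f (u + ?d))) (k + L)"
    by (rule padic_cong_sym)
  also have "padic_cong (to_fract (f (u + ?d))) (to_fract (f u) + to_fract ?d * g' u) (k + L)"
    using g' L unfolding has_derivative_mod_def L_def by (meson max.cobounded2)
  finally show ?thesis
    by (simp only: padic_cong_add_left_iff padic_cong_p_power_mult_left_iff)
qed

lemma has_derivative_mod_cong:
  assumes f': "has_derivative_mod k f N f'" and g': "\<And>u. padic_cong (f' u) (g' u) k"
  shows "has_derivative_mod k f N g'"
  unfolding has_derivative_mod_def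
proof (intro allI impI)
  fix K u and h :: "'a padic_int"
  assume K: "N \<le> K" and h: "padic_norm (to_fract h) \<le> real CARD('a) powi (- int K)"
  have "padic_cong (to_fract (f (u + h))) (to_fract (f u) + to_fract h * f' u) (k + K)"
    using f' K h unfolding has_derivative_mod_def by blast
  also have "padic_cong (to_fract (f u) + to_fract h * f' u)
      (to_fract (f u) + to_fract h * g' u) (k + K)"
    using padic_cong_mult_left[OF h g'] by (simp only: padic_cong_add_left_iff)
  finally show "padic_cong (to_fract (f (u + h))) (to_fract (f u) + to_fract h * g' u) (k + K)" .
qed

definition has_int_derivative_mod ::
  "nat \<Rightarrow> ('p :: prime_card padic_int \<Rightarrow> 'p padic_int) \<Rightarrow> nat \<Rightarrow> ('p padic_int \<Rightarrow> 'p padic_int) \<Rightarrow> bool"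
where
  "has_int_derivative_mod k f N D \<longleftrightarrow>
    (\<forall>K\<ge>N. \<forall>u h. padic_p ^ K dvd h \<longrightarrow> [f (u + h) \<equiv> f u + h * D u] (mod padic_p ^ (k + K)))"

lemma has_int_derivative_modD:
  assumes "has_int_derivative_mod k f N D" and "N \<le> K" and "padic_p ^ K dvd h"
  shows "[f (u + h) \<equiv> f u + h * D u] (mod padic_p ^ (k + K))"
  using assms by (simp add: has_int_derivative_mod_def)

lemma has_derivative_mod_to_fract_iff:
  "has_derivative_mod k f N (\<lambda>u. to_fract (D u)) \<longleftrightarrow> has_int_derivative_mod k f N D"
  unfolding has_derivative_mod_def has_int_derivative_mod_def
  by (simp add: padic_norm_to_fract_le_iff padic_cong_to_fract_iff residue_eq_0_iff_dvd
      residue_eq_iff_ring_cong flip: to_fract_mult to_fract_add)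

lemma integer_valued_derivative_modE:
  assumes "integer_valued_derivative_mod k f"
  obtains N D where "has_derivative_mod k f N (\<lambda>u. to_fract (D u))"
proof -
  from assms obtain N f' where f': "has_derivative_mod k f N f'" and "\<forall>u. \<exists>d. f' u = to_fract d"
    unfolding integer_valued_derivative_mod_def by blast
  then obtain D where "\<forall>u. f' u = to_fract (D u)"
    by metis
  then have "f' = (\<lambda>u. to_fract (D u))" by auto
  with f' that show thesis by blast
qed

lemma has_int_derivative_mod_N_mod:
  assumes "uniformly_differentiable_mod k f" and "integer_valued_derivative_mod k f"
  obtains D where "has_int_derivative_mod k f (N_mod k f) D"
proof -
  obtain g' where g': "has_derivative_mod k f (N_mod k f) g'"
    unfolding N_mod_def using assms(1) LeastI_ex[of "\<lambda>N. \<exists>f'. has_derivative_mod k f N f'"]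
    by (auto simp: uniformly_differentiable_mod_def)
  obtain N D where D: "has_derivative_mod k f N (\<lambda>u. to_fract (D u))"
    using assms(2) by (rule integer_valued_derivative_modE)
  have "has_derivative_mod k f (N_mod k f) (\<lambda>u. to_fract (D u))"
    using g' by (rule has_derivative_mod_cong) (rule has_derivative_mod_unique[OF g' D])
  with that show thesis by (simp add: has_derivative_mod_to_fract_iff)
qed

definition compatible_mod :: "nat \<Rightarrow> ('p :: prime_card padic_int \<Rightarrow> 'p padic_int) \<Rightarrow> bool" where
  "compatible_mod k f \<longleftrightarrow>
    (\<forall>x y. [x \<equiv> y] (mod padic_p ^ k) \<longrightarrow> [f x \<equiv> f y] (mod padic_p ^ k))"

lemma compatible_modD:
  "compatible_mod k f \<Longrightarrow> [x \<equiv> y] (mod padic_p ^ k) \<Longrightarrow> [f x \<equiv> f y] (mod padic_p ^ k)"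
  by (simp add: compatible_mod_def)

lemma compatible_mod_funpow_0:
  assumes f: "compatible_mod k f" and dvd_f0: "padic_p ^ k dvd f 0"
  shows "padic_p ^ k dvd (f ^^ i) 0"
proof (induction i)
  case (Suc i)
  then have "[f ((f ^^ i) 0) \<equiv> f 0] (mod padic_p ^ k)"
    by (intro compatible_modD[OF f]) (simp add: ring_cong_0_iff)
  with dvd_f0 show ?case by (simp add: ring_cong_dvd_iff)
qed simp

lemma has_int_derivative_mod_compatible:
  assumes "has_int_derivative_mod k f N D" and "N \<le> K"
  shows "compatible_mod K f"
  unfolding compatible_mod_def
proof (intro allI impI)
  fix x y :: "'a padic_int"
  assume "[x \<equiv> y] (mod padic_p ^ K)"
  then have dvd_x_minus_y: "padic_p ^ K dvd x - y" by (simp add: ring_cong_def)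
  have "[f (y + (x - y)) \<equiv> f y + (x - y) * D y] (mod padic_p ^ K)"
    using has_int_derivative_modD[OF assms dvd_x_minus_y]
    by (rule ring_cong_dvd_modulus) (simp add: le_imp_power_dvd)
  also have "[f y + (x - y) * D y \<equiv> f y + 0] (mod padic_p ^ K)"
    using dvd_x_minus_y by (intro ring_cong_add ring_cong_refl) (simp add: ring_cong_0_iff)
  finally show "[f x \<equiv> f y] (mod padic_p ^ K)" by simp
qed

lemma has_int_derivative_mod_comp:
  assumes f: "has_int_derivative_mod k f N D" and g: "has_int_derivative_mod k g N E"
  shows "has_int_derivative_mod k (f \<circ> g) N (\<lambda>u. D (g u) * E u)"
  unfolding has_int_derivative_mod_def
proof (intro allI impI)
  fix K and u h :: "'a padic_int"
  assume K: "N \<le> K" and h: "padic_p ^ K dvd h"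
  define d where "d = g (u + h) - g u"
  have d_cong: "[d \<equiv> h * E u] (mod padic_p ^ (k + K))"
    using has_int_derivative_modD[OF g K h, of u] by (simp add: d_def ring_cong_def diff_diff_eq)
  have "[g (u + h) \<equiv> g u] (mod padic_p ^ K)"
    using h by (intro compatible_modD[OF has_int_derivative_mod_compatible[OF g K]])
      (simp add: ring_cong_def)
  then have "padic_p ^ K dvd d" by (simp add: d_def ring_cong_def)
  then have "[f (g u + d) \<equiv> f (g u) + d * D (g u)] (mod padic_p ^ (k + K))"
    by (rule has_int_derivative_modD[OF f K])
  also have "[f (g u) + d * D (g u) \<equiv> f (g u) + h * E u * D (g u)] (mod padic_p ^ (k + K))"
    by (intro ring_cong_add ring_cong_mult ring_cong_refl d_cong)
  finally show "[(f \<circ> g) (u + h) \<equiv> (f \<circ> g) u + h * (D (g u) * E u)] (mod padic_p ^ (k + K))"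
    by (simp add: d_def ac_simps)
qed

lemma has_int_derivative_mod_funpow:
  assumes "has_int_derivative_mod k f N D"
  shows "has_int_derivative_mod k (f ^^ n) N (\<lambda>u. \<Prod>i<n. D ((f ^^ i) u))"
proof (induction n)
  case 0
  show ?case by (simp add: has_int_derivative_mod_def)
next
  case (Suc n)
  have "has_int_derivative_mod k (f \<circ> f ^^ n) N (\<lambda>u. D ((f ^^ n) u) * (\<Prod>i<n. D ((f ^^ i) u)))"
    using assms Suc by (rule has_int_derivative_mod_comp)
  then show ?case by (simp only: funpow.simps prod.lessThan_Suc mult.commute)
qed

lemma has_int_derivative_mod_periodic:
  fixes f :: "'p :: prime_card padic_int \<Rightarrow> 'p padic_int"
  assumes f: "has_int_derivative_mod k f N D" and h: "padic_p ^ N dvd h"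
  shows "[D (u + h) \<equiv> D u] (mod padic_p ^ k)"
proof -
  let ?d = "padic_p ^ N :: 'p padic_int"
  note fD = has_int_derivative_modD[OF f order_refl]
  have "[f u + h * D u + ?d * D (u + h) \<equiv> f (u + h) + ?d * D (u + h)] (mod padic_p ^ (k + N))"
    by (intro ring_cong_add ring_cong_refl ring_cong_sym[OF fD[OF h]])
  also have "[f (u + h) + ?d * D (u + h) \<equiv> f (u + (h + ?d))] (mod padic_p ^ (k + N))"
    using ring_cong_sym[OF fD[of ?d "u + h"]] by (simp add: add.assoc)
  also have "[f (u + (h + ?d)) \<equiv> f u + (h + ?d) * D u] (mod padic_p ^ (k + N))"
    using h by (intro fD dvd_add dvd_refl)
  finally have "?d * padic_p ^ k dvd ?d * (D (u + h) - D u)"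
    by (simp add: ring_cong_def algebra_simps power_add)
  then show ?thesis by (simp add: ring_cong_def del: of_nat_power)
qed

lemma has_int_derivative_mod_funpow_at_0:
  fixes g :: "'p :: prime_card padic_int \<Rightarrow> 'p padic_int"
  assumes g: "has_int_derivative_mod k g N E" and dvd_g0: "padic_p ^ N dvd g 0"
  obtains E' where "has_int_derivative_mod k (g ^^ n) N E'" and "[E' 0 \<equiv> E 0 ^ n] (mod padic_p ^ k)"
proof
  show "has_int_derivative_mod k (g ^^ n) N (\<lambda>u. \<Prod>i<n. E ((g ^^ i) u))"
    using g by (rule has_int_derivative_mod_funpow)
  have "[E ((g ^^ i) 0) \<equiv> E 0] (mod padic_p ^ k)" for i
    using has_int_derivative_mod_periodic[OF g, of "(g ^^ i) 0" 0]
      compatible_mod_funpow_0[OF has_int_derivative_mod_compatible[OF g] dvd_g0] by simp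
  then have "[(\<Prod>i<n. E ((g ^^ i) 0)) \<equiv> (\<Prod>i<n. E 0)] (mod padic_p ^ k)"
    by (rule ring_cong_prod)
  then show "[(\<Prod>i<n. E ((g ^^ i) 0)) \<equiv> E 0 ^ n] (mod padic_p ^ k)" by simp
qed

lemma funpow_0_cong_sum_powers:
  fixes g :: "'p :: prime_card padic_int \<Rightarrow> 'p padic_int"
  assumes g: "has_int_derivative_mod k g N E" and M: "N \<le> M" and dvd_g0: "padic_p ^ M dvd g 0"
  shows "[(g ^^ n) 0 \<equiv> g 0 * (\<Sum>i<n. E 0 ^ i)] (mod padic_p ^ (k + M))"
proof (induction n)
  case (Suc n)
  let ?x = "(g ^^ n) 0" and ?S = "\<Sum>i<n. E 0 ^ i"
  have "padic_p ^ M dvd ?x"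
    using has_int_derivative_mod_compatible[OF g M] dvd_g0 by (rule compatible_mod_funpow_0)
  then have "[g ?x \<equiv> g 0 + ?x * E 0] (mod padic_p ^ (k + M))"
    using has_int_derivative_modD[OF g M, of ?x 0] by simp
  also have "[g 0 + ?x * E 0 \<equiv> g 0 + g 0 * ?S * E 0] (mod padic_p ^ (k + M))"
    by (intro ring_cong_add ring_cong_mult ring_cong_refl Suc)
  also have "g 0 + g 0 * ?S * E 0 = g 0 * (\<Sum>i<Suc n. E 0 ^ i)"
    by (simp only: sum.lessThan_Suc_shift)
      (simp add: sum_distrib_left sum_distrib_right algebra_simps)
  finally show ?case by simp
qed simp

subsection \<open>Transitivity modulo \<open>p\<^sup>k\<close>\<close>

lemma reduction_mod_less:
  fixes f :: "'p :: prime_card padic_int \<Rightarrow> 'p padic_int"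
  shows "reduction_mod k f x < CARD('p) ^ k"
  using residue_bounds[of "f (of_nat x)" k]
  by (simp add: reduction_mod_def nat_less_iff)

lemma funpow_reduction_mod:
  fixes f :: "'p :: prime_card padic_int \<Rightarrow> 'p padic_int"
  assumes "compatible_mod k f"
  shows "(reduction_mod k f ^^ i) 0 = nat (residue ((f ^^ i) 0) k)"
proof (induction i)
  case (Suc i)
  let ?x = "(f ^^ i) 0"
  have "[f (of_nat (nat (residue ?x k))) \<equiv> f ?x] (mod padic_p ^ k)"
    using assms of_nat_residue_cong by (rule compatible_modD)
  with Suc show ?case
    by (simp add: reduction_mod_def flip: residue_eq_iff_ring_cong)
qed simp

lemma transitive_mod_iff_orbit:
  fixes f :: "'p :: prime_card padic_int \<Rightarrow> 'p padic_int"
  shows "transitive_mod k f \<longleftrightarrow> orbit (reduction_mod k f) 0 = {..<CARD('p) ^ k}"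
  unfolding transitive_mod_def by (rule bij_betw_cyclic_on_iff_orbit) simp_all

lemma transitive_mod_iff_return_times:
  fixes f :: "'p :: prime_card padic_int \<Rightarrow> 'p padic_int"
  assumes f: "compatible_mod k f"
  shows "transitive_mod k f \<longleftrightarrow> (\<forall>i. padic_p ^ k dvd (f ^^ i) 0 \<longleftrightarrow> CARD('p) ^ k dvd i)"
proof -
  have "(reduction_mod k f ^^ i) 0 = 0 \<longleftrightarrow> padic_p ^ k dvd (f ^^ i) 0" for i
    using residue_bounds(1)[of "(f ^^ i) 0" k]
    by (simp add: funpow_reduction_mod[OF f] flip: residue_eq_0_iff_dvd)
  then show ?thesis
    unfolding transitive_mod_iff_orbit
    by (subst orbit_eq_iff_return_times) (auto simp: reduction_mod_less)
qed

lemma in_orbit_reduction_mod_iff: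
  fixes f :: "'p :: prime_card padic_int \<Rightarrow> 'p padic_int"
  assumes f: "compatible_mod k f" and "a < CARD('p) ^ k"
  shows "a \<in> orbit (reduction_mod k f) 0 \<longleftrightarrow>
    (\<exists>i>0. [(f ^^ i) 0 \<equiv> of_nat a] (mod padic_p ^ k))"
proof -
  have "residue (of_nat a :: 'p padic_int) k = int a"
    unfolding residue_of_nat using assms(2) by (simp flip: of_nat_power)
  then have "a = nat (residue x k) \<longleftrightarrow> [x \<equiv> of_nat a] (mod padic_p ^ k)" for x :: "'p padic_int"
    using residue_bounds(1)[of x k] by (auto simp flip: residue_eq_iff_ring_cong)
  then show ?thesis
    by (auto simp: orbit_altdef funpow_reduction_mod[OF f])
qed

lemma transitive_mod_iff_reaches_all:
  fixes f :: "'p :: prime_card padic_int \<Rightarrow> 'p padic_int"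
  assumes f: "compatible_mod k f"
  shows "transitive_mod k f \<longleftrightarrow> (\<forall>x. \<exists>i>0. [(f ^^ i) 0 \<equiv> x] (mod padic_p ^ k))"
    (is "_ \<longleftrightarrow> ?reaches_all")
proof -
  have "orbit (reduction_mod k f) 0 \<subseteq> {..<CARD('p) ^ k}"
    by (rule orbit_subset_invariant) (auto simp: reduction_mod_less)
  then have "transitive_mod k f \<longleftrightarrow> (\<forall>a<CARD('p) ^ k. a \<in> orbit (reduction_mod k f) 0)"
    unfolding transitive_mod_iff_orbit by auto
  also have "\<dots> \<longleftrightarrow> (\<forall>a<CARD('p) ^ k. \<exists>i>0. [(f ^^ i) 0 \<equiv> of_nat a] (mod padic_p ^ k))"
    using in_orbit_reduction_mod_iff[OF f] by simp
  also have "\<dots> \<longleftrightarrow> ?reaches_all"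
  proof (intro iffI allI)
    fix x :: "'p padic_int"
    assume reaches_nats: "\<forall>a<CARD('p) ^ k. \<exists>i>0. [(f ^^ i) 0 \<equiv> of_nat a] (mod padic_p ^ k)"
    have "nat (residue x k) < CARD('p) ^ k"
      using residue_bounds[of x k] by (simp add: nat_less_iff)
    with reaches_nats obtain i
      where "0 < i" and "[(f ^^ i) 0 \<equiv> of_nat (nat (residue x k))] (mod padic_p ^ k)"
      by blast
    then show "\<exists>i>0. [(f ^^ i) 0 \<equiv> x] (mod padic_p ^ k)"
      using ring_cong_trans[OF _ of_nat_residue_cong] by blast
  qed blast
  finally show ?thesis .
qed

lemma transitive_mod_antimono:
  assumes "compatible_mod k f" and "compatible_mod l f" and "k \<le> l" and "transitive_mod l f"
  shows "transitive_mod k f"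
  using assms(3,4)
  unfolding transitive_mod_iff_reaches_all[OF assms(1)] transitive_mod_iff_reaches_all[OF assms(2)]
  by (blast intro: ring_cong_dvd_modulus le_imp_power_dvd)

lemma transitive_mod_funpow_0:
  fixes f :: "'p :: prime_card padic_int \<Rightarrow> 'p padic_int"
  assumes "compatible_mod k f" and "transitive_mod k f"
  shows "padic_p ^ k dvd (f ^^ CARD('p) ^ k) 0"
  using assms by (simp add: transitive_mod_iff_return_times)

lemma transitive_mod_Suc_iff_return_times:
  fixes f :: "'p :: prime_card padic_int \<Rightarrow> 'p padic_int"
  assumes compat: "compatible_mod M f" "compatible_mod (Suc M) f"
    and trans: "transitive_mod M f"
  shows "transitive_mod (Suc M) f \<longleftrightarrow>
    (\<forall>n. padic_p ^ Suc M dvd ((f ^^ CARD('p) ^ M) ^^ n) 0 \<longleftrightarrow> CARD('p) dvd n)"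
proof -
  have return: "padic_p ^ M dvd (f ^^ i) 0 \<longleftrightarrow> CARD('p) ^ M dvd i" for i
    using trans transitive_mod_iff_return_times[OF compat(1)] by blast
  have multiple: "\<exists>n. i = CARD('p) ^ M * n"
    if "padic_p ^ Suc M dvd (f ^^ i) 0 \<or> CARD('p) ^ Suc M dvd i" for i
    using that return[of i] by (auto dest: power_le_dvd[where m = M])
  have "transitive_mod (Suc M) f \<longleftrightarrow>
      (\<forall>i. padic_p ^ Suc M dvd (f ^^ i) 0 \<longleftrightarrow> CARD('p) ^ Suc M dvd i)"
    by (rule transitive_mod_iff_return_times[OF compat(2)])
  also have "\<dots> \<longleftrightarrow> (\<forall>n. padic_p ^ Suc M dvd (f ^^ (CARD('p) ^ M * n)) 0 \<longleftrightarrow>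
      CARD('p) ^ Suc M dvd CARD('p) ^ M * n)"
    using multiple by blast
  also have "\<dots> \<longleftrightarrow> (\<forall>n. padic_p ^ Suc M dvd ((f ^^ CARD('p) ^ M) ^^ n) 0 \<longleftrightarrow> CARD('p) dvd n)"
  proof -
    have "CARD('p) ^ Suc M dvd CARD('p) ^ M * n \<longleftrightarrow> CARD('p) dvd n" for n
      unfolding power_Suc2 by (rule nat_mult_dvd_cancel1) simp
    then show ?thesis by (simp only: funpow_mult)
  qed
  finally show ?thesis .
qed

lemma transitive_mod_Suc_iff:
  fixes f :: "'p :: prime_card padic_int \<Rightarrow> 'p padic_int"
  assumes compat: "compatible_mod M f" "compatible_mod (Suc M) f"
    and trans: "transitive_mod M f"
    and E: "has_int_derivative_mod k (f ^^ CARD('p) ^ M) N E" and "0 < k" and "N \<le> M"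
  shows "transitive_mod (Suc M) f \<longleftrightarrow>
    \<not> padic_p ^ Suc M dvd (f ^^ CARD('p) ^ M) 0 \<and> [E 0 \<equiv> 1] (mod padic_p)"
proof -
  let ?g = "f ^^ CARD('p) ^ M"
  have dvd_g0: "padic_p ^ M dvd ?g 0"
    using compat(1) trans by (rule transitive_mod_funpow_0)
  then obtain b where g0_eq: "?g 0 = padic_p ^ M * b" by (rule dvdE)
  have "padic_p ^ Suc M dvd (?g ^^ n) 0 \<longleftrightarrow> padic_p dvd b * (\<Sum>i<n. E 0 ^ i)" for n
  proof -
    have "[(?g ^^ n) 0 \<equiv> ?g 0 * (\<Sum>i<n. E 0 ^ i)] (mod padic_p ^ Suc M)"
      using funpow_0_cong_sum_powers[OF E \<open>N \<le> M\<close> dvd_g0]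
      by (rule ring_cong_dvd_modulus) (use \<open>0 < k\<close> in \<open>intro le_imp_power_dvd, simp\<close>)
    then have "padic_p ^ Suc M dvd (?g ^^ n) 0 \<longleftrightarrow>
        padic_p ^ M * padic_p dvd padic_p ^ M * (b * (\<Sum>i<n. E 0 ^ i))"
      unfolding g0_eq power_Suc2 mult.assoc by (rule ring_cong_dvd_iff)
    then show ?thesis by simp
  qed
  moreover have "padic_p ^ Suc M dvd ?g 0 \<longleftrightarrow> padic_p dvd b"
    unfolding g0_eq power_Suc2 by simp
  ultimately show ?thesis
    using transitive_mod_Suc_iff_return_times[OF compat trans] padic_p_dvd_mult_sum_powers_iff
    by simp
qed

lemma padic_p_power_dvd_funpow_0_iff:
  fixes g :: "'p :: prime_card padic_int \<Rightarrow> 'p padic_int"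
  assumes g: "has_int_derivative_mod 2 g N E" and M: "N \<le> M" and dvd_g0: "padic_p ^ M dvd g 0"
    and sum: "[(\<Sum>i<CARD('p). E 0 ^ i) \<equiv> padic_p] (mod padic_p ^ 2)"
  shows "padic_p ^ Suc (Suc M) dvd (g ^^ CARD('p)) 0 \<longleftrightarrow> padic_p ^ Suc M dvd g 0"
proof -
  have "[(g ^^ CARD('p)) 0 \<equiv> g 0 * (\<Sum>i<CARD('p). E 0 ^ i)] (mod padic_p ^ (2 + M))"
    by (rule funpow_0_cong_sum_powers[OF g M dvd_g0])
  also have "[g 0 * (\<Sum>i<CARD('p). E 0 ^ i) \<equiv> g 0 * padic_p] (mod padic_p ^ (2 + M))"
    unfolding add.commute[of 2] power_add by (rule ring_cong_mult_moduli[OF dvd_g0 sum])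
  finally have "padic_p ^ Suc (Suc M) dvd (g ^^ CARD('p)) 0 \<longleftrightarrow>
      padic_p ^ Suc (Suc M) dvd g 0 * padic_p"
    unfolding add_2_eq_Suc by (rule ring_cong_dvd_iff)
  also have "\<dots> \<longleftrightarrow> padic_p ^ Suc M dvd g 0"
    unfolding power_Suc2[of _ "Suc M"] dvd_mult_cancel_right by simp
  finally show ?thesis .
qed

lemma transitive_mod_Suc_Suc:
  fixes f :: "'p :: prime_card padic_int \<Rightarrow> 'p padic_int"
  assumes f: "has_int_derivative_mod 2 f N D" and M: "N \<le> M" and trans: "transitive_mod (Suc M) f"
    and E: "has_int_derivative_mod 2 (f ^^ CARD('p) ^ M) N E"
    and sum: "[E 0 \<equiv> 1] (mod padic_p) \<Longrightarrow> [(\<Sum>i<CARD('p). E 0 ^ i) \<equiv> padic_p] (mod padic_p ^ 2)"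
  shows "transitive_mod (Suc (Suc M)) f"
proof -
  let ?g = "f ^^ CARD('p) ^ M" and ?G = "f ^^ CARD('p) ^ Suc M"
  have compat: "compatible_mod K f" if "N \<le> K" for K
    using f that by (rule has_int_derivative_mod_compatible)
  have trans_M: "transitive_mod M f"
    by (rule transitive_mod_antimono[OF compat compat _ trans]) (use M in simp_all)
  with compat[OF M] have dvd_g0: "padic_p ^ M dvd ?g 0"
    by (rule transitive_mod_funpow_0)
  have not_dvd_g0: "\<not> padic_p ^ Suc M dvd ?g 0" and E0_cong_1: "[E 0 \<equiv> 1] (mod padic_p)"
    using trans transitive_mod_Suc_iff[OF compat compat trans_M E] M by simp_all
  have G: "?G = ?g ^^ CARD('p)"
    by (simp add: funpow_mult mult.commute)
  obtain E' where E': "has_int_derivative_mod 2 ?G N E'"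
    and E'0_cong: "[E' 0 \<equiv> E 0 ^ CARD('p)] (mod padic_p ^ 2)"
    unfolding G using has_int_derivative_mod_funpow_at_0[OF E power_le_dvd[OF dvd_g0 M]] .
  have "[E' 0 \<equiv> E 0 ^ CARD('p)] (mod padic_p)"
    using E'0_cong by (rule ring_cong_dvd_modulus) (simp add: power2_eq_square)
  also have "[E 0 ^ CARD('p) \<equiv> 1 ^ CARD('p)] (mod padic_p)"
    using E0_cong_1 by (rule ring_cong_power)
  finally have "[E' 0 \<equiv> 1] (mod padic_p)" by simp
  moreover have "\<not> padic_p ^ Suc (Suc M) dvd ?G 0"
    unfolding G
    using not_dvd_g0 padic_p_power_dvd_funpow_0_iff[OF E M dvd_g0 sum[OF E0_cong_1]] by simp
  ultimately show ?thesis
    using transitive_mod_Suc_iff[OF compat compat trans E'] M by simp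
qed

lemma transitive_mod_Suc:
  fixes f :: "'p :: prime_card padic_int \<Rightarrow> 'p padic_int"
  assumes f: "has_int_derivative_mod 2 f N D" and "Suc N < k"
    and trans: "transitive_mod k f"
  shows "transitive_mod (Suc k) f"
proof -
  obtain M where k: "k = Suc (Suc M)" and M: "N \<le> M"
    using \<open>Suc N < k\<close> that[of "k - 2"] by simp
  let ?g = "f ^^ CARD('p) ^ M"
  have compat: "compatible_mod K f" if "N \<le> K" for K
    using f that by (rule has_int_derivative_mod_compatible)
  have trans_M: "transitive_mod M f" and trans_Suc_M: "transitive_mod (Suc M) f"
    by (rule transitive_mod_antimono[OF compat compat _ trans]; use M k in simp)+
  obtain E where E: "has_int_derivative_mod 2 ?g N E"
    using has_int_derivative_mod_funpow[OF f] by blast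
  have E0_cong_1: "[E 0 \<equiv> 1] (mod padic_p)"
    using trans_Suc_M transitive_mod_Suc_iff[OF compat compat trans_M E] M by simp
  have "padic_p ^ N dvd ?g 0"
    using transitive_mod_funpow_0[OF compat[OF M] trans_M] M by (rule power_le_dvd)
  then obtain E' where E': "has_int_derivative_mod 2 (?g ^^ CARD('p)) N E'"
    and E'0_cong: "[E' 0 \<equiv> E 0 ^ CARD('p)] (mod padic_p ^ 2)"
    by (rule has_int_derivative_mod_funpow_at_0[OF E])
  have "[E' 0 \<equiv> 1] (mod padic_p ^ 2)"
    using E'0_cong power_cong_1_square_modulus[OF E0_cong_1] by (rule ring_cong_trans)
  then have sum: "[(\<Sum>i<CARD('p). E' 0 ^ i) \<equiv> padic_p] (mod padic_p ^ 2)"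
    by (rule sum_powers_cong)
  have "has_int_derivative_mod 2 (f ^^ CARD('p) ^ Suc M) N E'"
    using E' by (simp add: funpow_mult mult.commute)
  from transitive_mod_Suc_Suc[OF f _ _ this sum] show ?thesis
    using trans M by (simp add: k)
qed

lemma transitive_mod_Suc_odd:
  fixes f :: "'p :: prime_card padic_int \<Rightarrow> 'p padic_int"
  assumes f: "has_int_derivative_mod 2 f N D" and "N < k"
    and trans: "transitive_mod k f" and p: "odd CARD('p)"
  shows "transitive_mod (Suc k) f"
proof -
  obtain M where M: "k = Suc M" "N \<le> M" using \<open>N < k\<close> by (cases k) auto
  show ?thesis
    using trans unfolding M(1)
    by (rule transitive_mod_Suc_Suc[OF f M(2) _ has_int_derivative_mod_funpow[OF f]])
      (rule sum_powers_cong_square_modulus[OF p])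
qed

lemma asymptotically_ergodic_iff_transitive_mod:
  assumes compat: "\<And>j. k \<le> j \<Longrightarrow> compatible_mod j f"
    and step: "\<And>j. k \<le> j \<Longrightarrow> transitive_mod j f \<Longrightarrow> transitive_mod (Suc j) f"
  shows "asymptotically_ergodic f \<longleftrightarrow> transitive_mod k f"
proof
  assume "asymptotically_ergodic f"
  then obtain k0 where "transitive_mod (max k0 k) f"
    unfolding asymptotically_ergodic_def by (meson max.cobounded1)
  then show "transitive_mod k f"
    by (rule transitive_mod_antimono[OF compat compat, rotated 3]) simp_all
next
  assume k: "transitive_mod k f"
  have "transitive_mod j f" if "k \<le> j" for j
    using that by (induction j rule: dec_induct) (simp_all add: k step)
  then show "asymptotically_ergodic f" by (auto simp: asymptotically_ergodic_def)
qed

theorem theorem3p14: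
  fixes f :: "'p :: prime_card padic_int \<Rightarrow> 'p padic_int"
  assumes "uniformly_differentiable_mod 2 f"
    and "integer_valued_derivative_mod 2 f"
  shows "(odd CARD('p) \<longrightarrow>
            (asymptotically_ergodic f \<longleftrightarrow> transitive_mod (N_mod 2 f + 1) f)) \<and>
         (CARD('p) = 2 \<longrightarrow>
            (asymptotically_ergodic f \<longleftrightarrow> transitive_mod (N_mod 2 f + 2) f))"
proof -
  obtain D where D: "has_int_derivative_mod 2 f (N_mod 2 f) D"
    by (rule has_int_derivative_mod_N_mod[OF assms])
  have "asymptotically_ergodic f \<longleftrightarrow> transitive_mod (N_mod 2 f + 1) f" if "odd CARD('p)"
    using that by (intro asymptotically_ergodic_iff_transitive_mod
        has_int_derivative_mod_compatible[OF D] transitive_mod_Suc_odd[OF D]) simp_all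
  moreover have "asymptotically_ergodic f \<longleftrightarrow> transitive_mod (N_mod 2 f + 2) f"
    by (intro asymptotically_ergodic_iff_transitive_mod
        has_int_derivative_mod_compatible[OF D] transitive_mod_Suc[OF D]) simp_all
  ultimately show ?thesis by blast
qed

end
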